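(* Let $d\in\mathbb N$, $a\in\mathbb N_0$. For every $n\in\mathbb N_0$, as polynomials in $x$, $$\sum_{m=0}^n\widehat{S1p}(d,a;n,m)\,x^m=\mathrm{risefac}(d,a;x,n),$$ where $\mathrm{risefac}(d,a;x,n):=\prod_{j=0}^{n-1}\big(x+(a+j\,d)\big)$ for $n\ge1$ and $\mathrm{risefac}(d,a;x,0):=1$.
   Context: $\mathbb N=\{1,2,\dots\}$, $\mathbb N_0=\{0,1,2,\dots\}$. The generalized Stirling numbers of the second kind $S2(d,a;n,m)$, $0\le m\le n$, are defined by the operator identity $(a\,\mathbf 1+d\,\mathbf E_x)^n=\sum_{m=0}^n S2(d,a;n,m)\,x^m\,\mathbf d_x^{\,m}$, where $\mathbf d_x$ is differentiation with respect to $x$, $\mathbf E_x:=x\,\mathbf d_x$ and $\mathbf 1$ is the identity operator; $S2(d,a;n,m):=0$ for $m>n$. Let $\mathbf{S1}[d,a]=(S1(d,a;n,m))_{n,m\ge0}$ be the inverse of the infinite lower triangular matrix $\mathbf{S2}[d,a]=(S2(d,a;n,m))_{n,m\ge0}$, and set $\widehat{S1p}(d,a;n,m):=d^n\,(-1)^{n-m}\,S1(d,a;n,m)$. *)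

theory Defs
  imports Complex_Main "HOL-Computational_Algebra.Polynomial"
begin

definition euler_op :: "rat poly \<Rightarrow> rat poly" where
  "euler_op p = [:0, 1:] * pderiv p"

definition affine_euler_op :: "nat \<Rightarrow> nat \<Rightarrow> rat poly \<Rightarrow> rat poly" where
  "affine_euler_op d a p = smult (of_nat a) p + smult (of_nat d) (euler_op p)"

text \<open>The operator identity is read on the polynomial ring over the rationals; this already
  determines the coefficients, see \<open>ex1_is_S2\<close>.\<close>

definition is_S2 :: "nat \<Rightarrow> nat \<Rightarrow> (nat \<Rightarrow> nat \<Rightarrow> rat) \<Rightarrow> bool" where
  "is_S2 d a S \<longleftrightarrow>
     (\<forall>n p. (affine_euler_op d a ^^ n) p
              = (\<Sum>m=0..n. smult (S n m) (monom 1 m * (pderiv ^^ m) p))) \<and>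
     (\<forall>n m. m > n \<longrightarrow> S n m = 0)"

definition S2 :: "nat \<Rightarrow> nat \<Rightarrow> nat \<Rightarrow> nat \<Rightarrow> rat" where
  "S2 d a = (THE S. is_S2 d a S)"

definition lower_triangular :: "(nat \<Rightarrow> nat \<Rightarrow> rat) \<Rightarrow> bool" where
  "lower_triangular A \<longleftrightarrow> (\<forall>n m. m > n \<longrightarrow> A n m = 0)"

text \<open>For a lower triangular left factor the entry \<open>(n, m)\<close> of the product of infinite matrices
  is the finite sum below.\<close>

definition lt_mult :: "(nat \<Rightarrow> nat \<Rightarrow> rat) \<Rightarrow> (nat \<Rightarrow> nat \<Rightarrow> rat) \<Rightarrow> nat \<Rightarrow> nat \<Rightarrow> rat" where
  "lt_mult A B n m = (\<Sum>k=0..n. A n k * B k m)"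

definition id_matrix :: "nat \<Rightarrow> nat \<Rightarrow> rat" where
  "id_matrix n m = (if n = m then 1 else 0)"

definition is_lt_inverse :: "(nat \<Rightarrow> nat \<Rightarrow> rat) \<Rightarrow> (nat \<Rightarrow> nat \<Rightarrow> rat) \<Rightarrow> bool" where
  "is_lt_inverse A B \<longleftrightarrow>
     lower_triangular B \<and> lt_mult A B = id_matrix \<and> lt_mult B A = id_matrix"

text \<open>The diagonal entries of the matrix are \<open>d ^ n\<close>, so the inverse exists exactly when
  \<open>d \<noteq> 0\<close>; see \<open>ex1_is_lt_inverse_S2\<close>.\<close>

definition S1 :: "nat \<Rightarrow> nat \<Rightarrow> nat \<Rightarrow> nat \<Rightarrow> rat" where
  "S1 d a = (THE T. is_lt_inverse (S2 d a) T)"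

text \<open>The truncated exponent \<open>n - m\<close> for \<open>m > n\<close> is harmless: the entry of \<open>S1\<close> is then 0.\<close>

definition S1p_hat :: "nat \<Rightarrow> nat \<Rightarrow> nat \<Rightarrow> nat \<Rightarrow> rat" where
  "S1p_hat d a n m = of_nat d ^ n * (- 1) ^ (n - m) * S1 d a n m"

definition risefac :: "nat \<Rightarrow> nat \<Rightarrow> nat \<Rightarrow> rat poly" where
  "risefac d a n = (\<Prod>j<n. [:0, 1:] + [:of_nat (a + j * d):])"

fun S2_rec :: "nat \<Rightarrow> nat \<Rightarrow> nat \<Rightarrow> nat \<Rightarrow> rat" where
  "S2_rec d a 0 m = (if m = 0 then 1 else 0)"
| "S2_rec d a (Suc n) m = of_nat (a + d * m) * S2_rec d a n m
      + (if m = 0 then 0 else of_nat d * S2_rec d a n (m - 1))"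

lemma S2_rec_0: "m > n \<Longrightarrow> S2_rec d a n m = 0"
  by (induction n arbitrary: m) auto

lemma affine_euler_op_sum:
  "affine_euler_op d a (\<Sum>m\<in>A. f m) = (\<Sum>m\<in>A. affine_euler_op d a (f m))"
proof -
  have add: "affine_euler_op d a (p + q) = affine_euler_op d a p + affine_euler_op d a q" for p q
    unfolding affine_euler_op_def euler_op_def pderiv_add distrib_left smult_add_right
    by (simp only: add_ac)
  have zero: "affine_euler_op d a 0 = 0"
    by (simp add: affine_euler_op_def euler_op_def)
  show ?thesis
    by (induction A rule: infinite_finite_induct) (simp_all add: add zero)
qed

lemma affine_euler_op_term:
  "affine_euler_op d a (smult c (monom 1 m * q)) =
     smult (of_nat (a + d * m) * c) (monom 1 m * q) + smult (of_nat d * c) (monom 1 (Suc m) * pderiv q)"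
proof -
  have X: "[:0, 1:] * monom 1 k = monom (1::rat) (Suc k)" for k
    by (simp add: monom_Suc)
  have "euler_op (monom 1 m * q) = smult (of_nat m) (monom 1 m * q) + monom 1 (Suc m) * pderiv q"
  proof (cases m)
    case 0
    then show ?thesis by (simp add: euler_op_def monom_Suc)
  next
    case (Suc k)
    have "pderiv (monom (1::rat) m) = smult (of_nat m) (monom 1 k)"
      using Suc by (simp add: pderiv_monom smult_monom)
    then have "euler_op (monom 1 m * q)
        = ([:0, 1:] * monom 1 m) * pderiv q + smult (of_nat m) (([:0, 1:] * monom 1 k) * q)"
      unfolding euler_op_def pderiv_mult by (simp add: algebra_simps del: mult_pCons_left mult_pCons_right)
    then show ?thesis unfolding X Suc by simp
  qed
  moreover have "euler_op (smult c (monom 1 m * q)) = smult c (euler_op (monom 1 m * q))"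
    by (simp add: euler_op_def pderiv_smult)
  ultimately show ?thesis
    by (simp add: affine_euler_op_def smult_add_right smult_add_left algebra_simps)
qed

lemma is_S2_S2_rec: "is_S2 d a (S2_rec d a)"
proof -
  have "(affine_euler_op d a ^^ n) p
      = (\<Sum>m=0..n. smult (S2_rec d a n m) (monom 1 m * (pderiv ^^ m) p))" for n p
  proof (induction n)
    case 0
    show ?case by simp
  next
    case (Suc n)
    define t where "t m = monom 1 m * (pderiv ^^ m) p" for m
    have "(affine_euler_op d a ^^ Suc n) p =
       (\<Sum>m=0..n. smult (of_nat (a + d * m) * S2_rec d a n m) (t m))
       + (\<Sum>m=0..n. smult (of_nat d * S2_rec d a n m) (t (Suc m)))"
      by (simp add: Suc affine_euler_op_sum affine_euler_op_term t_def sum.distrib)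
    also have "(\<Sum>m=0..n. smult (of_nat (a + d * m) * S2_rec d a n m) (t m))
        = (\<Sum>m=0..Suc n. smult (of_nat (a + d * m) * S2_rec d a n m) (t m))"
      by (simp add: S2_rec_0)
    also have "(\<Sum>m=0..n. smult (of_nat d * S2_rec d a n m) (t (Suc m)))
        = (\<Sum>m=0..Suc n. smult (if m = 0 then 0 else of_nat d * S2_rec d a n (m - 1)) (t m))"
      by (subst sum.atLeast0_atMost_Suc_shift) simp
    finally show ?case
      by (simp only: t_def sum.distrib[symmetric] smult_add_left[symmetric] S2_rec.simps)
  qed
  then show ?thesis by (simp add: is_S2_def S2_rec_0)
qed

lemma pderiv_pow_monom:
  "(pderiv ^^ k) (monom (1::rat) m) = (if k \<le> m then monom (fact m / fact (m - k)) (m - k) else 0)"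
proof (induction k)
  case (Suc k)
  show ?case
  proof (cases "Suc k \<le> m")
    case True
    then have "m - k = Suc (m - Suc k)" by simp
    then show ?thesis using Suc True by (simp add: pderiv_monom)
  next
    case False
    then show ?thesis using Suc by (auto simp: pderiv_monom)
  qed
qed simp

lemma is_S2_unique:
  assumes "is_S2 d a S" "is_S2 d a T"
  shows "S = T"
proof -
  have "S n m = T n m" if "m \<le> n" for n m
    using that
  proof (induction m rule: less_induct)
    case (less m)
    let ?t = "\<lambda>k. monom 1 k * (pderiv ^^ k) (monom (1::rat) m)"
    have "(\<Sum>k=0..n. smult (S n k) (?t k)) = (\<Sum>k=0..n. smult (T n k) (?t k))"
      using assms unfolding is_S2_def by metis
    then have "(\<Sum>k=0..n. smult (S n k - T n k) (?t k)) = 0"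
      by (simp add: smult_diff_left sum_subtractf)
    also have "(\<Sum>k=0..n. smult (S n k - T n k) (?t k))
        = (\<Sum>k=0..n. if k = m then smult (S n m - T n m) (?t m) else 0)"
    proof (intro sum.cong refl)
      fix k assume "k \<in> {0..n}"
      then show "smult (S n k - T n k) (?t k) = (if k = m then smult (S n m - T n m) (?t m) else 0)"
        using less by (cases k m rule: linorder_cases) (auto simp: pderiv_pow_monom)
    qed
    also have "\<dots> = smult (S n m - T n m) (?t m)" using less by simp
    finally show ?case by (simp add: pderiv_pow_monom mult_monom monom_eq_0_iff)
  qed
  moreover have "S n m = T n m" if "m > n" for n m
    using assms that by (simp add: is_S2_def)
  ultimately show ?thesis by (intro ext) (meson not_le)
qed

theorem ex1_is_S2: "\<exists>!S. is_S2 d a S"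
  using is_S2_S2_rec is_S2_unique by blast

lemma S2_eq_S2_rec: "S2 d a = S2_rec d a"
  unfolding S2_def using is_S2_S2_rec is_S2_unique by blast

fun S1_rec :: "nat \<Rightarrow> nat \<Rightarrow> nat \<Rightarrow> nat \<Rightarrow> rat" where
  "S1_rec d a 0 m = (if m = 0 then 1 else 0)"
| "S1_rec d a (Suc n) m =
     ((if m = 0 then 0 else S1_rec d a n (m - 1)) - of_nat (a + d * n) * S1_rec d a n m) / of_nat d"

lemma S1_rec_0: "m > n \<Longrightarrow> S1_rec d a n m = 0"
  by (induction n arbitrary: m) auto

lemma lt_mult_S2_S1:
  assumes "d \<ge> 1"
  shows "lt_mult (S2_rec d a) (S1_rec d a) n m = id_matrix n m"
proof (induction n arbitrary: m)
  case 0
  show ?case by (simp add: lt_mult_def id_matrix_def)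
next
  case (Suc n)
  let ?s = "S2_rec d a" and ?t = "S1_rec d a"
  have "lt_mult ?s ?t (Suc n) m = (\<Sum>k=0..Suc n. of_nat (a + d * k) * ?s n k * ?t k m)
     + (\<Sum>k=0..Suc n. (if k = 0 then 0 else of_nat d * ?s n (k - 1)) * ?t k m)"
    by (simp only: lt_mult_def S2_rec.simps distrib_right sum.distrib)
  also have "(\<Sum>k=0..Suc n. of_nat (a + d * k) * ?s n k * ?t k m)
     = (\<Sum>k=0..n. of_nat (a + d * k) * ?s n k * ?t k m)"
    by (simp add: S2_rec_0)
  also have "(\<Sum>k=0..Suc n. (if k = 0 then 0 else of_nat d * ?s n (k - 1)) * ?t k m)
     = (\<Sum>k=0..n. of_nat d * ?s n k * ?t (Suc k) m)"
    by (subst sum.atLeast0_atMost_Suc_shift) simp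
  also have "(\<Sum>k=0..n. of_nat (a + d * k) * ?s n k * ?t k m) + \<dots>
     = (\<Sum>k=0..n. ?s n k * (if m = 0 then 0 else ?t k (m - 1)))"
    unfolding sum.distrib[symmetric]
    by (intro sum.cong refl) (use assms in \<open>simp add: field_simps\<close>)
  also have "\<dots> = (if m = 0 then 0 else lt_mult ?s ?t n (m - 1))"
    by (simp add: lt_mult_def)
  finally show ?case using Suc by (auto simp: id_matrix_def)
qed

lemma lt_mult_S1_S2:
  assumes "d \<ge> 1"
  shows "lt_mult (S1_rec d a) (S2_rec d a) n m = id_matrix n m"
proof (induction n arbitrary: m)
  case 0
  show ?case by (simp add: lt_mult_def id_matrix_def)
next
  case (Suc n)
  let ?s = "S2_rec d a" and ?t = "S1_rec d a"
  have "of_nat d * lt_mult ?t ?s (Suc n) m =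
     (\<Sum>k=0..Suc n. ((if k = 0 then 0 else ?t n (k - 1)) - of_nat (a + d * n) * ?t n k) * ?s k m)"
    unfolding lt_mult_def sum_distrib_left using assms by (intro sum.cong refl) simp
  also have "\<dots> = (\<Sum>k=0..Suc n. (if k = 0 then 0 else ?t n (k - 1)) * ?s k m)
     - (\<Sum>k=0..Suc n. of_nat (a + d * n) * (?t n k * ?s k m))"
    by (simp only: left_diff_distrib sum_subtractf mult.assoc)
  also have "(\<Sum>k=0..Suc n. of_nat (a + d * n) * (?t n k * ?s k m))
     = of_nat (a + d * n) * lt_mult ?t ?s n m"
    by (simp add: S1_rec_0 lt_mult_def sum_distrib_left)
  also have "(\<Sum>k=0..Suc n. (if k = 0 then 0 else ?t n (k - 1)) * ?s k m)
     = (\<Sum>k=0..n. ?t n k * ?s (Suc k) m)"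
    by (subst sum.atLeast0_atMost_Suc_shift) simp
  also have "\<dots> = of_nat (a + d * m) * lt_mult ?t ?s n m
      + (if m = 0 then 0 else of_nat d * lt_mult ?t ?s n (m - 1))"
    by (simp add: lt_mult_def sum_distrib_left sum.distrib algebra_simps)
  finally have "of_nat d * lt_mult ?t ?s (Suc n) m = of_nat d * id_matrix (Suc n) m"
    unfolding Suc by (auto simp: id_matrix_def)
  then show ?case using assms by simp
qed

lemma lt_mult_assoc:
  assumes "lower_triangular B"
  shows "lt_mult A (lt_mult B C) n m = lt_mult (lt_mult A B) C n m"
proof -
  have "lt_mult B C k m = (\<Sum>j=0..n. B k j * C j m)" if "k \<le> n" for k
    unfolding lt_mult_def
    by (rule sum.mono_neutral_left) (use that assms in \<open>auto simp: lower_triangular_def\<close>)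
  then have "lt_mult A (lt_mult B C) n m = (\<Sum>k=0..n. \<Sum>j=0..n. A n k * (B k j * C j m))"
    by (simp add: lt_mult_def[of A] sum_distrib_left)
  also have "\<dots> = (\<Sum>j=0..n. \<Sum>k=0..n. A n k * (B k j * C j m))" by (rule sum.swap)
  finally show ?thesis by (simp add: lt_mult_def sum_distrib_right mult.assoc)
qed

lemma is_lt_inverse_unique:
  assumes "lower_triangular A" "is_lt_inverse A B" "is_lt_inverse A C"
  shows "B = C"
proof (intro ext)
  fix n m
  have l: "lt_mult id_matrix D n m = D n m" for D
    by (simp add: lt_mult_def id_matrix_def if_distrib if_distribR cong: if_cong)
  have r: "lt_mult B id_matrix n m = B n m"
    using assms(2)
    by (auto simp: lt_mult_def id_matrix_def if_distrib is_lt_inverse_def lower_triangular_def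
             cong: if_cong)
  have "B n m = lt_mult B (lt_mult A C) n m" using assms(3) r by (simp add: is_lt_inverse_def)
  also have "\<dots> = lt_mult (lt_mult B A) C n m" by (rule lt_mult_assoc[OF assms(1)])
  also have "\<dots> = C n m" using assms(2) l by (simp add: is_lt_inverse_def)
  finally show "B n m = C n m" .
qed

theorem ex1_is_lt_inverse_S2:
  assumes "d \<ge> 1"
  shows "\<exists>!T. is_lt_inverse (S2 d a) T"
proof -
  have "is_lt_inverse (S2 d a) (S1_rec d a)"
    unfolding is_lt_inverse_def S2_eq_S2_rec lower_triangular_def
    using assms by (auto simp: S1_rec_0 lt_mult_S2_S1 lt_mult_S1_S2 intro!: ext)
  moreover have "lower_triangular (S2 d a)"
    by (simp add: S2_eq_S2_rec lower_triangular_def S2_rec_0)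
  ultimately show ?thesis using is_lt_inverse_unique by blast
qed

end

theory Submission imports Defs begin

text \<open>The inverse matrix satisfies d * S1(n+1,m) = S1(n,m-1) - (a + n*d) * S1(n,m). Scaling by
  d^n and (-1)^(n-m) clears the division and the minus sign (\<open>S1p_hat_Suc\<close>), leaving
  the rule by which coefficients change on multiplication by x + (a + n*d). Induction on n then
  matches the coefficients of \<open>risefac\<close> (\<open>coeff_risefac\<close>).\<close>

lemma S1_eq_S1_rec:
  assumes "d \<ge> 1"
  shows "S1 d a = S1_rec d a"
proof -
  have "is_lt_inverse (S2 d a) (S1_rec d a)"
    unfolding is_lt_inverse_def S2_eq_S2_rec lower_triangular_def
    using assms by (auto simp: S1_rec_0 lt_mult_S2_S1 lt_mult_S1_S2 intro!: ext)
  then show ?thesis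
    unfolding S1_def using ex1_is_lt_inverse_S2[OF assms] by (rule the1_equality[rotated])
qed

lemma S1p_hat_eq_0:
  assumes "d \<ge> 1" "m > n"
  shows "S1p_hat d a n m = 0"
  using assms by (simp add: S1p_hat_def S1_eq_S1_rec S1_rec_0)

lemma S1p_hat_Suc:
  assumes "d \<ge> 1"
  shows "S1p_hat d a (Suc n) m =
    (if m = 0 then 0 else S1p_hat d a n (m - 1)) + of_nat (a + n * d) * S1p_hat d a n m"
proof (cases "m \<le> n")
  case True
  then have "Suc n - m = Suc (n - m)" by simp
  moreover have "n - (m - 1) = Suc (n - m)" if "m \<noteq> 0" using that True by simp
  ultimately show ?thesis
    using assms by (simp add: S1p_hat_def S1_eq_S1_rec field_simps)
next
  case False
  \<comment> \<open>For m > n, truncated subtraction makes the exponents Suc n - m and n - (m - 1)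
    both 0, so the signs still agree.\<close>
  then have "S1_rec d a n m = 0" by (simp add: S1_rec_0)
  with False assms show ?thesis
    by (cases m) (simp_all add: S1p_hat_def S1_eq_S1_rec)
qed

lemma coeff_risefac:
  assumes "d \<ge> 1"
  shows "coeff (risefac d a n) m = S1p_hat d a n m"
proof (induction n arbitrary: m)
  case 0
  show ?case using assms by (simp add: risefac_def S1p_hat_def S1_eq_S1_rec)
next
  case (Suc n)
  have "risefac d a (Suc n) = pCons 0 (risefac d a n) + smult (of_nat (a + n * d)) (risefac d a n)"
    by (simp add: risefac_def algebra_simps)
  then show ?case
    using Suc by (simp add: S1p_hat_Suc[OF assms] coeff_pCons split: nat.split)
qed

theorem mainTheorem17:
  fixes d a n :: nat
  assumes "d \<ge> 1"
  shows "(\<Sum>m=0..n. monom (S1p_hat d a n m) m) = risefac d a n"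
  \<comment> \<open>Beyond degree n the sum has no term, so the entries there must vanish.\<close>
  by (rule poly_eqI) (auto simp: coeff_sum coeff_risefac[OF assms] S1p_hat_eq_0[OF assms])

end
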